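(* Let $0<\lambda<1$ be given. Then the set $$\{\delta\in[0,1):\rho_{\lambda,\delta}\text{ is an irrational number}\}$$ has zero Hausdorff dimension, where $\rho_{\lambda,\delta}$ is the rotation number of the contracted rotation $f_{\lambda,\delta}$.
   Context: For $x\in\mathbb{R}$, $[x]$ denotes the integer part (floor) and $\{x\}=x-[x]$ the fractional part. Let $I=[0,1)$. For $0<\lambda<1$ and $\delta\in I$, the contracted rotation is the map $f_{\lambda,\delta}:I\to I$, $f_{\lambda,\delta}(x)=\{\lambda x+\delta\}$. Its lift is $F_{\lambda,\delta}:\mathbb{R}\to\mathbb{R}$, $F_{\lambda,\delta}(x)=\lambda\{x\}+\delta+[x]$. The rotation number of $f_{\lambda,\delta}$ is $$\rho_{\lambda,\delta}=\lim_{k\to\infty}\frac{F_{\lambda,\delta}^k(x_0)}{k},$$ where $F_{\lambda,\delta}^k$ is the $k$-th iterate; it is known that the limit exists, does not depend on $x_0\in\mathbb{R}$, and satisfies $0\le\rho_{\lambda,\delta}<1$. *)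

theory Defs
  imports "HOL-Analysis.Analysis"
begin

section \<open>Hausdorff dimension\<close>

text \<open>The conventions are the usual ones: the empty set contributes \<open>0\<close> for every \<open>s\<close>, and a
  nonempty set contributes \<open>1\<close> for \<open>s = 0\<close>, whereas \<open>0 powr 0 = 0\<close>.\<close>

definition diameter_pow :: "real \<Rightarrow> 'a::metric_space set \<Rightarrow> ennreal" where
  "diameter_pow s U =
     (if U = {} then 0 else if s = 0 then 1 else ennreal (diameter U powr s))"

text \<open>Boundedness is required explicitly because \<^const>\<open>diameter\<close> is real-valued and is
  unspecified on unbounded sets. Finite covers are included, by padding with empty sets.\<close>

definition countable_cover :: "real \<Rightarrow> 'a::metric_space set \<Rightarrow> (nat \<Rightarrow> 'a set) \<Rightarrow> bool" where
  "countable_cover \<eta> S U \<longleftrightarrow>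
     S \<subseteq> (\<Union>i. U i) \<and> (\<forall>i. bounded (U i) \<and> diameter (U i) \<le> \<eta>)"

definition hausdorff_premeasure :: "real \<Rightarrow> real \<Rightarrow> 'a::metric_space set \<Rightarrow> ennreal" where
  "hausdorff_premeasure s \<eta> S = (INF U\<in>{U. countable_cover \<eta> S U}. \<Sum>i. diameter_pow s (U i))"

definition hausdorff_measure :: "real \<Rightarrow> 'a::metric_space set \<Rightarrow> ennreal" where
  "hausdorff_measure s S = (SUP \<eta>\<in>{0<..}. hausdorff_premeasure s \<eta> S)"

definition hausdorff_dim :: "'a::metric_space set \<Rightarrow> ennreal" where
  "hausdorff_dim S = (INF s\<in>{s. 0 \<le> s \<and> hausdorff_measure s S = 0}. ennreal s)"


section \<open>Contracted rotations\<close>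

definition contracted_rotation :: "real \<Rightarrow> real \<Rightarrow> real \<Rightarrow> real" where
  "contracted_rotation l \<delta> x = frac (l * x + \<delta>)"

definition contracted_rotation_lift :: "real \<Rightarrow> real \<Rightarrow> real \<Rightarrow> real" where
  "contracted_rotation_lift l \<delta> x = l * frac x + \<delta> + of_int \<lfloor>x\<rfloor>"

lemma frac_contracted_rotation_lift:
  "frac (contracted_rotation_lift l \<delta> x) = contracted_rotation l \<delta> (frac x)"
  by (simp add: contracted_rotation_lift_def contracted_rotation_def frac_def)

text \<open>The rotation number is the common limit for all starting points; for \<open>0 < l < 1\<close> and
  \<open>0 \<le> \<delta> < 1\<close> it is classical that this limit exists and does not depend on the starting point.\<close>

definition rotation_number :: "real \<Rightarrow> real \<Rightarrow> real" where
  "rotation_number l \<delta> =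
     (THE r. \<forall>x0. (\<lambda>k. (contracted_rotation_lift l \<delta> ^^ k) x0 / real k) \<longlonglongrightarrow> r)"

end

theory Submission
  imports Defs "HOL-Real_Asymp.Real_Asymp"
begin

text \<open>Let \<open>x\<^sub>k\<close> be the orbit of \<open>0\<close> under the lift, and group the parameters \<open>\<delta>\<close> by the integer parts of
  \<open>x\<^sub>0, \<dots>, x\<^sub>N\<close> and by the time \<open>q \<le> N\<close> of the closest return \<open>t = frac x\<^sub>q\<close> to \<open>0\<close> from the right.
  Since \<open>x\<^sub>k\<close> increases with \<open>\<delta>\<close>, there are only polynomially many groups. Up to time \<open>N\<close> the
  itinerary is \<open>q\<close>-periodic, the displacement at the \<open>j\<close>-th return being
  \<open>t (1 - l\<^sup>j\<^sup>q) / (1 - l\<^sup>q)\<close>. If the rotation number is irrational, there is no periodic point, and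
  so the itinerary breaks before the displacement reaches \<open>t / (1 - l\<^sup>q)\<close>. Two parameters of a group
  therefore have values of \<open>t\<close>, and a fortiori of \<open>\<delta>\<close>, that differ by at most \<open>l\<^sup>j\<^sup>q t\<close>. As \<open>t \<le> l\<^sup>q\<^sup>-\<^sup>1\<close> by
  contraction, this is exponentially small in \<open>N\<close>.\<close>

section \<open>Hausdorff dimension zero from finite covers\<close>

text \<open>At every scale \<open>\<eta> > r n\<close> the cover costs at most
  \<open>M n * r n powr s\<close>, which tends to 0. Hence each \<open>s > 0\<close> has measure 0
  and is admissible in the infimum that defines the dimension.\<close>

lemma hausdorff_dim_eq_0I:
  fixes S :: "'a::metric_space set" and M :: "nat \<Rightarrow> nat" and r :: "nat \<Rightarrow> real"
  assumes cover: "\<And>n. \<exists>U. S \<subseteq> (\<Union>i<M n. U i) \<and> (\<forall>i<M n. bounded (U i) \<and> diameter (U i) \<le> r n)"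
    and r: "r \<longlonglongrightarrow> 0"
    and small: "\<And>s. 0 < s \<Longrightarrow> (\<lambda>n. real (M n) * r n powr s) \<longlonglongrightarrow> 0"
  shows "hausdorff_dim S = 0"
proof -
  have premeasure: "hausdorff_premeasure s \<eta> S = 0" if "0 < s" "0 < \<eta>" for s \<eta> :: real
  proof (rule antisym[OF ennreal_le_epsilon])
    fix e :: real assume "0 < e"
    have "\<forall>\<^sub>F n in sequentially. r n < \<eta> \<and> real (M n) * r n powr s < e"
      using order_tendstoD(2)[OF r \<open>0 < \<eta>\<close>] order_tendstoD(2)[OF small[OF \<open>0 < s\<close>] \<open>0 < e\<close>]
      by (rule eventually_conj)
    then obtain n where n: "r n < \<eta>" "real (M n) * r n powr s < e"
      by (auto simp: eventually_sequentially)
    obtain U where U: "S \<subseteq> (\<Union>i<M n. U i)"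
      "\<And>i. i < M n \<Longrightarrow> bounded (U i)" "\<And>i. i < M n \<Longrightarrow> diameter (U i) \<le> r n"
      using cover[of n] by blast
    define V where "V i = (if i < M n then U i else {})" for i
    have "countable_cover \<eta> S V"
      using U n \<open>0 < \<eta>\<close> by (force simp: countable_cover_def V_def)
    then have "hausdorff_premeasure s \<eta> S \<le> (\<Sum>i. diameter_pow s (V i))"
      unfolding hausdorff_premeasure_def by (intro INF_lower) simp
    also have "\<dots> = (\<Sum>i<M n. diameter_pow s (V i))"
      by (rule suminf_finite) (auto simp: V_def diameter_pow_def)
    also have "\<dots> \<le> (\<Sum>i<M n. ennreal (r n powr s))"
      using U \<open>0 < s\<close>
      by (intro sum_mono)
        (auto simp: V_def diameter_pow_def intro!: ennreal_leI powr_mono2 diameter_ge_0)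
    also have "\<dots> = ennreal (real (M n) * r n powr s)"
      by (simp add: ennreal_mult ennreal_of_nat_eq_real_of_nat)
    also have "\<dots> \<le> 0 + ennreal e"
      using n by (simp add: ennreal_leI)
    finally show "hausdorff_premeasure s \<eta> S \<le> 0 + ennreal e" .
  qed simp
  have measure: "hausdorff_measure s S = 0" if "0 < s" for s
    unfolding hausdorff_measure_def using premeasure[OF that]
    by (simp add: SUP_eq_iff)
  show ?thesis
  proof (rule antisym[OF ennreal_le_epsilon])
    fix e :: real assume "0 < e"
    then show "hausdorff_dim S \<le> 0 + ennreal e"
      unfolding hausdorff_dim_def using measure by (auto intro!: INF_lower)
  qed simp
qed


section \<open>The lift of a contracted rotation\<close>

text \<open>With \<open>N = 2 * n + 1\<close> this is \<open>((N + 1) * N + 1) * (N + 1)\<close>: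
  the possible itinerary sums from 0 to \<open>(N + 1) * N\<close>, times slots from 0 to
  \<open>N\<close> for the return time.\<close>

definition irrational_cover_size :: "nat \<Rightarrow> nat" where
  "irrational_cover_size n = ((2 * n + 2) * (2 * n + 1) + 1) * (2 * n + 2)"

context
  fixes l :: real
  assumes l_pos: "0 < l" and l_less_1: "l < 1"
begin

abbreviation lift where "lift \<equiv> contracted_rotation_lift l"
abbreviation orbit where "orbit \<delta> k \<equiv> (lift \<delta> ^^ k) 0"

lemma lift_diff_same_floor:
  assumes "\<lfloor>y\<rfloor> = \<lfloor>x\<rfloor>"
  shows "lift \<delta> y = lift \<delta> x + l * (y - x)"
  using assms by (simp add: contracted_rotation_lift_def frac_def algebra_simps)

lemma lift_add_int: "lift \<delta> (x + of_int m) = lift \<delta> x + of_int m"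
  by (simp add: contracted_rotation_lift_def)

lemma lift_param: "lift \<delta>' x = lift \<delta> x + (\<delta>' - \<delta>)"
  by (simp add: contracted_rotation_lift_def)

lemma lift_eq_lift_0: "lift \<delta> x = lift \<delta> 0 + of_int \<lfloor>x\<rfloor> + l * frac x"
  by (simp add: contracted_rotation_lift_def)

lemma lift_le: "lift \<delta> x \<le> x + \<delta>"
proof -
  have "l * frac x \<le> 1 * frac x"
    using l_less_1 by (intro mult_right_mono) auto
  then show ?thesis
    by (simp add: contracted_rotation_lift_def frac_def)
qed

text \<open>Each branch has slope \<open>l > 0\<close>, and at every integer the lift jumps up by
  \<open>1 - l > 0\<close>.\<close>

lemma mono_lift: "mono (lift \<delta>)"
proof
  fix x y :: real assume "x \<le> y"
  show "lift \<delta> x \<le> lift \<delta> y"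
  proof (cases "\<lfloor>y\<rfloor> = \<lfloor>x\<rfloor>")
    case True
    then show ?thesis
      using lift_diff_same_floor[OF True, of \<delta>] \<open>x \<le> y\<close> l_pos by simp
  next
    case False
    then have "\<lfloor>x\<rfloor> + 1 \<le> \<lfloor>y\<rfloor>"
      using floor_mono[OF \<open>x \<le> y\<close>] by linarith
    then have "of_int \<lfloor>x\<rfloor> + 1 \<le> (of_int \<lfloor>y\<rfloor> :: real)"
      by linarith
    moreover have "l * frac x \<le> 1" "0 \<le> l * frac y"
      using l_pos l_less_1 frac_lt_1[of x] by (auto intro!: mult_le_one)
    ultimately show ?thesis
      by (simp add: contracted_rotation_lift_def)
  qed
qed

lemma funpow_lift_add_int: "(lift \<delta> ^^ k) (x + of_int m) = (lift \<delta> ^^ k) x + of_int m"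
  by (induction k) (simp_all add: lift_add_int)

text \<open>The orbit of \<open>y\<close> stays within bounded distance of \<open>k * p / q\<close>.
  By monotonicity any other orbit is squeezed between two integer translates of it, so all orbits
  share the limit \<open>p / q\<close>.\<close>

lemma rotation_number_Rats_of_periodic:
  assumes "0 < q" and per: "(lift \<delta> ^^ q) y = y + of_int p"
  shows "rotation_number l \<delta> \<in> \<rat>"
proof -
  let ?r = "real_of_int p / real q"
  have per_iter: "(lift \<delta> ^^ (j * q)) y = y + of_int (int j * p)" for j
  proof (induction j)
    case (Suc j)
    have "(lift \<delta> ^^ (Suc j * q)) y = (lift \<delta> ^^ q) ((lift \<delta> ^^ (j * q)) y)"
      by (simp add: funpow_add)
    also have "\<dots> = y + of_int p + of_int (int j * p)"
      unfolding Suc by (simp only: funpow_lift_add_int per)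
    finally show ?case by (simp add: algebra_simps)
  qed simp
  \<comment> \<open>The deviation from \<open>k * ?r\<close> is \<open>q\<close>-periodic in
    \<open>k\<close>, so the sum over one period bounds it.\<close>
  define C where "C = (\<Sum>i<q. \<bar>(lift \<delta> ^^ i) y - i * ?r\<bar>)"
  have y_bound: "\<bar>(lift \<delta> ^^ k) y - k * ?r\<bar> \<le> C" for k
  proof -
    let ?i = "k mod q" and ?j = "k div q"
    have k: "k = ?i + ?j * q" by simp
    have "(lift \<delta> ^^ k) y = (lift \<delta> ^^ ?i) y + of_int (int ?j * p)"
      by (subst k, simp only: funpow_add o_apply per_iter funpow_lift_add_int)
    moreover have "real k = ?i + real ?j * q"
      by (metis k of_nat_add of_nat_mult)
    ultimately have "(lift \<delta> ^^ k) y - k * ?r = (lift \<delta> ^^ ?i) y - ?i * ?r"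
      using \<open>0 < q\<close> by (simp add: field_simps)
    moreover have "\<bar>(lift \<delta> ^^ ?i) y - ?i * ?r\<bar> \<le> C"
      unfolding C_def using \<open>0 < q\<close> by (intro member_le_sum) auto
    ultimately show ?thesis by simp
  qed
  have limit: "(\<lambda>k. (lift \<delta> ^^ k) x / real k) \<longlonglongrightarrow> ?r" for x
  proof -
    define m where "m = \<lceil>\<bar>x - y\<bar>\<rceil>"
    have m: "y + of_int (- m) \<le> x" "x \<le> y + of_int m"
      unfolding m_def by linarith+
    have x_bound: "\<bar>(lift \<delta> ^^ k) x - k * ?r\<bar> \<le> C + m" for k
      using funpow_mono[OF mono_lift m(1), of k \<delta>] funpow_mono[OF mono_lift m(2), of k \<delta>]
        y_bound[of k]
      unfolding funpow_lift_add_int by simp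
    have "(\<lambda>k. (lift \<delta> ^^ k) x / real k - ?r) \<longlonglongrightarrow> 0"
    proof (rule Lim_null_comparison)
      show "\<forall>\<^sub>F k in sequentially. norm ((lift \<delta> ^^ k) x / real k - ?r) \<le> (C + m) / real k"
        using eventually_gt_at_top[of 0]
      proof eventually_elim
        case (elim k)
        then have "(lift \<delta> ^^ k) x / real k - ?r = ((lift \<delta> ^^ k) x - k * ?r) / real k"
          by (simp add: field_simps)
        with elim x_bound[of k] show ?case
          by (simp add: divide_right_mono)
      qed
      show "(\<lambda>k. (C + m) / real k) \<longlonglongrightarrow> 0"
        by (rule lim_const_over_n)
    qed
    then show ?thesis
      by (simp add: LIM_zero_iff)
  qed
  have "rotation_number l \<delta> = ?r"
    unfolding rotation_number_def
    by (rule the_equality) (use limit LIMSEQ_unique in blast)+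
  then show ?thesis by simp
qed


section \<open>The orbit of the discontinuity\<close>

text \<open>The last application of the lift contributes the whole parameter difference, and by
  monotonicity the earlier steps cannot cancel it. At \<open>k = 0\<close> both orbits are still at
  0.\<close>

lemma orbit_diff_ge:
  assumes "\<delta> \<le> \<delta>'" "0 < k"
  shows "orbit \<delta> k + (\<delta>' - \<delta>) \<le> orbit \<delta>' k"
  using \<open>0 < k\<close>
proof (induction k rule: nat_induct_non_zero)
  case 1
  then show ?case by (simp add: contracted_rotation_lift_def)
next
  case (Suc k)
  have "orbit \<delta> k \<le> orbit \<delta>' k"
    using Suc.IH \<open>\<delta> \<le> \<delta>'\<close> by linarith
  from monoD[OF mono_lift this, of \<delta>] show ?case
    using lift_param[of \<delta>' "orbit \<delta>' k" \<delta>] by simp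
qed

lemma orbit_mono: "\<delta> \<le> \<delta>' \<Longrightarrow> orbit \<delta> k \<le> orbit \<delta>' k"
  using orbit_diff_ge[of \<delta> \<delta>' k] by (cases "k = 0") auto

lemma orbit_bounds:
  assumes "0 \<le> \<delta>" "\<delta> < 1"
  shows "0 \<le> orbit \<delta> k" "orbit \<delta> k \<le> real k"
proof (induction k)
  case (Suc k)
  case 1
  have "0 \<le> lift \<delta> 0"
    using assms by (simp add: contracted_rotation_lift_def)
  also have "\<dots> \<le> lift \<delta> (orbit \<delta> k)"
    using Suc by (intro monoD[OF mono_lift])
  finally show ?case by simp
next
  case (Suc k)
  case 2
  show ?case
    using Suc(2) lift_le[of \<delta> "orbit \<delta> k"] \<open>\<delta> < 1\<close> by simp
qed auto

text \<open>The circle map sends its domain after \<open>n\<close> steps to arcs of total length \<open>l ^ n\<close>,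
  each starting at one of the first \<open>n\<close> points of the orbit of \<open>0\<close>.\<close>

lemma orbit_near_below:
  assumes "0 < n"
  shows "\<exists>k m. 0 < k \<and> k \<le> n \<and> orbit \<delta> k + of_int m \<le> (lift \<delta> ^^ n) y
    \<and> (lift \<delta> ^^ n) y \<le> orbit \<delta> k + of_int m + l ^ n"
  using assms
proof (induction n rule: nat_induct_non_zero)
  case 1
  have "l * frac y \<le> l"
    using l_pos frac_lt_1[of y] by (simp add: mult_left_le)
  then show ?case
    using l_pos
    by (intro exI[of _ 1] exI[of _ "\<lfloor>y\<rfloor>"]) (simp add: contracted_rotation_lift_def)
next
  case (Suc n)
  then obtain k m where k: "0 < k" "k \<le> n" and
    lower: "orbit \<delta> k + of_int m \<le> (lift \<delta> ^^ n) y" and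
    upper: "(lift \<delta> ^^ n) y \<le> orbit \<delta> k + of_int m + l ^ n" by blast
  let ?e = "orbit \<delta> k + of_int m" and ?y = "(lift \<delta> ^^ n) y"
  show ?case
  proof (cases "\<lfloor>?y\<rfloor> = \<lfloor>?e\<rfloor>")
    case True
    have "lift \<delta> ?y = orbit \<delta> (Suc k) + of_int m + l * (?y - ?e)"
      unfolding lift_diff_same_floor[OF True] by (simp add: lift_add_int)
    moreover have "0 \<le> l * (?y - ?e)" "l * (?y - ?e) \<le> l * l ^ n"
      using lower upper l_pos by simp_all
    ultimately show ?thesis
      using k by (intro exI[of _ "Suc k"] exI[of _ m]) simp
  next
    case False
    \<comment> \<open>An integer separates the two points. The arc is now measured from the image of
      the last integer up to \<open>?y\<close>, a translate of the first orbit point, so the index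
      restarts at 1.\<close>
    then have "\<lfloor>?e\<rfloor> < \<lfloor>?y\<rfloor>"
      using floor_mono[OF lower] by simp
    then have "?e < of_int \<lfloor>?y\<rfloor>"
      by (simp only: floor_less_iff)
    then have "frac ?y \<le> l ^ n"
      using upper unfolding frac_def by linarith
    then have "0 \<le> l * frac ?y" "l * frac ?y \<le> l * l ^ n"
      using l_pos by simp_all
    then show ?thesis
      by (intro exI[of _ "Suc 0"] exI[of _ "\<lfloor>?y\<rfloor>"]) (simp add: lift_eq_lift_0[of _ ?y])
  qed
qed

text \<open>The point \<open>orbit \<delta> q\<close> lies at most \<open>l ^ (q - 1)\<close> above
  a translate of an earlier orbit point. That point has a larger fractional part, so an integer lies
  in between. Starting from \<open>lift \<delta> 0\<close> with \<open>q - 1\<close> steps keeps the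
  earlier index below \<open>q\<close>.\<close>

lemma closest_return_le:
  assumes "0 < q" and first: "\<And>k. 0 < k \<Longrightarrow> k < q \<Longrightarrow> frac (orbit \<delta> q) < frac (orbit \<delta> k)"
  shows "frac (orbit \<delta> q) \<le> l ^ (q - 1)"
proof (cases "q = 1")
  case True
  then show ?thesis using frac_lt_1[of "orbit \<delta> q"] by simp
next
  case False
  then have "0 < q - 1" using \<open>0 < q\<close> by simp
  have "orbit \<delta> q = (lift \<delta> ^^ (q - 1)) (lift \<delta> 0)"
    using \<open>0 < q\<close> by (metis Suc_diff_1 funpow_Suc_right o_apply)
  with orbit_near_below[OF \<open>0 < q - 1\<close>, of \<delta> "lift \<delta> 0"] obtain k m where
    k: "0 < k" "k \<le> q - 1" and near: "orbit \<delta> k + of_int m \<le> orbit \<delta> q"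
      "orbit \<delta> q \<le> orbit \<delta> k + of_int m + l ^ (q - 1)"
    by metis
  have "frac (orbit \<delta> q) < frac (orbit \<delta> k + of_int m)"
    using first[of k] k \<open>0 < q\<close> by simp
  then have "\<lfloor>orbit \<delta> k + of_int m\<rfloor> \<noteq> \<lfloor>orbit \<delta> q\<rfloor>"
    using near(1) unfolding frac_def by auto
  then have "\<lfloor>orbit \<delta> k + of_int m\<rfloor> < \<lfloor>orbit \<delta> q\<rfloor>"
    using floor_mono[OF near(1)] by simp
  then have "orbit \<delta> k + of_int m < of_int \<lfloor>orbit \<delta> q\<rfloor>"
    by (simp only: floor_less_iff)
  then show ?thesis
    using near(2) unfolding frac_def by linarith
qed

text \<open>The displacement \<open>l ^ i * t\<close> is at most \<open>t\<close>, hence at most the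
  fractional part of \<open>orbit \<delta> (q + i)\<close>. Removing it crosses no integer, so both
  orbits stay on the same branch.\<close>

lemma orbit_after_closest_return:
  fixes \<delta> :: real and N q i :: nat
  defines "p \<equiv> \<lfloor>orbit \<delta> q\<rfloor>" and "t \<equiv> frac (orbit \<delta> q)"
  assumes closest: "\<And>k. 0 < k \<Longrightarrow> k \<le> N \<Longrightarrow> t \<le> frac (orbit \<delta> k)"
    and "q + i \<le> N"
  shows "orbit \<delta> (q + i) = orbit \<delta> i + of_int p + l ^ i * t
    \<and> \<lfloor>orbit \<delta> (q + i)\<rfloor> = \<lfloor>orbit \<delta> i\<rfloor> + p"
  using \<open>q + i \<le> N\<close>
proof (induction i)
  case 0
  then show ?case by (simp add: p_def t_def frac_def)
next
  case (Suc i)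
  then have IH: "orbit \<delta> (q + i) = orbit \<delta> i + of_int p + l ^ i * t"
    "\<lfloor>orbit \<delta> (q + i)\<rfloor> = \<lfloor>orbit \<delta> i + of_int p\<rfloor>"
    by (metis Suc_leD add_Suc_right, metis Suc_leD add_Suc_right floor_add_int)
  have eq: "orbit \<delta> (q + Suc i) = orbit \<delta> (Suc i) + of_int p + l ^ Suc i * t"
    using lift_diff_same_floor[OF IH(2), of \<delta>] IH(1) by (simp add: lift_add_int)
  have "0 \<le> t" by (simp add: t_def)
  then have "l ^ Suc i * t \<le> t"
    using l_pos l_less_1 by (intro mult_left_le_one_le power_le_one) auto
  also have "t \<le> frac (orbit \<delta> (q + Suc i))"
    using closest[of "q + Suc i"] Suc.prems by simp
  finally have "l ^ Suc i * t \<le> frac (orbit \<delta> (q + Suc i))" .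
  moreover have "0 \<le> l ^ Suc i * t"
    using \<open>0 \<le> t\<close> l_pos by simp
  ultimately have "\<lfloor>orbit \<delta> (Suc i) + of_int p\<rfloor> = \<lfloor>orbit \<delta> (q + Suc i)\<rfloor>"
    using eq unfolding frac_def by linarith
  with eq show ?case by simp
qed

text \<open>Iterating the previous lemma at the times \<open>j * q + i\<close> adds displacements
  \<open>l ^ (j * q + i) * t\<close>, which form a geometric sum.\<close>

lemma orbit_after_closest_returns:
  fixes \<delta> :: real and N q i j :: nat
  defines "p \<equiv> \<lfloor>orbit \<delta> q\<rfloor>" and "t \<equiv> frac (orbit \<delta> q)"
  assumes closest: "\<And>k. 0 < k \<Longrightarrow> k \<le> N \<Longrightarrow> t \<le> frac (orbit \<delta> k)"
    and "j * q + i \<le> N"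
  shows "orbit \<delta> (j * q + i) = orbit \<delta> i + of_int (int j * p) + l ^ i * t * (\<Sum>k<j. (l ^ q) ^ k)
    \<and> \<lfloor>orbit \<delta> (j * q + i)\<rfloor> = \<lfloor>orbit \<delta> i\<rfloor> + int j * p"
  using \<open>j * q + i \<le> N\<close>
proof (induction j)
  case (Suc j)
  have split: "Suc j * q + i = q + (j * q + i)" by simp
  have power: "l ^ (j * q + i) = l ^ i * (l ^ q) ^ j"
    by (simp add: power_add mult.commute flip: power_mult)
  have step: "orbit \<delta> (q + (j * q + i)) = orbit \<delta> (j * q + i) + of_int p + l ^ (j * q + i) * t
    \<and> \<lfloor>orbit \<delta> (q + (j * q + i))\<rfloor> = \<lfloor>orbit \<delta> (j * q + i)\<rfloor> + p"
    unfolding p_def t_def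
    by (rule orbit_after_closest_return[where N = N])
      (use closest Suc.prems in \<open>simp_all add: t_def\<close>)
  have IH: "orbit \<delta> (j * q + i) = orbit \<delta> i + of_int (int j * p) + l ^ i * t * (\<Sum>k<j. (l ^ q) ^ k)"
    "\<lfloor>orbit \<delta> (j * q + i)\<rfloor> = \<lfloor>orbit \<delta> i\<rfloor> + int j * p"
    using Suc.IH Suc.prems by (metis add_leD2 split)+
  show ?case
    unfolding split
  proof
    show "orbit \<delta> (q + (j * q + i)) = orbit \<delta> i + of_int (int (Suc j) * p)
        + l ^ i * t * (\<Sum>k<Suc j. (l ^ q) ^ k)"
      using step IH(1) power by (simp add: algebra_simps)
    show "\<lfloor>orbit \<delta> (q + (j * q + i))\<rfloor> = \<lfloor>orbit \<delta> i\<rfloor> + int (Suc j) * p"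
      using conjunct2[OF step] IH(2) by (simp add: distrib_right)
  qed
qed simp

text \<open>On the branch of \<open>0\<close> the \<open>q\<close>-th iterate is \<open>x \<mapsto> p + t + l ^ q * x\<close>. Its solution of
  \<open>x \<mapsto> x + p\<close> is \<open>t / (1 - l ^ q)\<close>, so that point must lie outside the branch.\<close>

lemma orbit_escapes_branch:
  assumes "0 < q" and irrational: "rotation_number l \<delta> \<notin> \<rat>"
  shows "\<exists>i<q. of_int \<lfloor>orbit \<delta> i\<rfloor> + 1 \<le> orbit \<delta> i + l ^ i * (frac (orbit \<delta> q) / (1 - l ^ q))"
proof (rule ccontr)
  define y where "y = frac (orbit \<delta> q) / (1 - l ^ q)"
  have "l ^ q < 1"
    using \<open>0 < q\<close> l_pos l_less_1 by (simp add: power_less_one_iff)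
  then have "0 \<le> y" and y_eq: "frac (orbit \<delta> q) + l ^ q * y = y"
    by (auto simp: y_def field_simps)
  assume "\<not> ?thesis"
  then have branch: "orbit \<delta> i + l ^ i * y < of_int \<lfloor>orbit \<delta> i\<rfloor> + 1" if "i < q" for i
    using that unfolding y_def by (meson not_le)
  have "(lift \<delta> ^^ i) y = orbit \<delta> i + l ^ i * y" if "i \<le> q" for i
    using that
  proof (induction i)
    case (Suc i)
    have "\<lfloor>orbit \<delta> i + l ^ i * y\<rfloor> = \<lfloor>orbit \<delta> i\<rfloor>"
      using branch[of i] Suc.prems \<open>0 \<le> y\<close> l_pos
      by (intro floor_unique) (auto intro: add_increasing2)
    from lift_diff_same_floor[OF this, of \<delta>] Suc show ?case by simp
  qed simp
  then have "(lift \<delta> ^^ q) y = y + of_int \<lfloor>orbit \<delta> q\<rfloor>"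
    using y_eq unfolding frac_def by fastforce
  with irrational rotation_number_Rats_of_periodic[OF \<open>0 < q\<close>] show False by blast
qed


section \<open>Parameters with a common itinerary\<close>

text \<open>Minimality up to \<open>N\<close> makes the itinerary periodic; choosing the first
  minimizing time gives the strict inequalities behind \<open>closest_return_le\<close>.\<close>

definition closest_return where
  "closest_return N \<delta> q \<longleftrightarrow> 0 < q \<and> q \<le> N
    \<and> (\<forall>k. 0 < k \<longrightarrow> k \<le> N \<longrightarrow> frac (orbit \<delta> q) \<le> frac (orbit \<delta> k))
    \<and> (\<forall>k. 0 < k \<longrightarrow> k < q \<longrightarrow> frac (orbit \<delta> q) < frac (orbit \<delta> k))"

lemma closest_return_exists:
  assumes "0 < N"
  shows "\<exists>q. closest_return N \<delta> q"
proof -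
  define P where "P q \<longleftrightarrow> 0 < q \<and> q \<le> N
    \<and> (\<forall>k. 0 < k \<longrightarrow> k \<le> N \<longrightarrow> frac (orbit \<delta> q) \<le> frac (orbit \<delta> k))" for q
  obtain q0 where "q0 \<in> {1..N}" "\<And>k. k \<in> {1..N} \<Longrightarrow> frac (orbit \<delta> q0) \<le> frac (orbit \<delta> k)"
    using ex_min_if_finite[of "(\<lambda>k. frac (orbit \<delta> k)) ` {1..N}"] assms
    by (fastforce simp: not_less)
  then have "P q0" by (auto simp: P_def)
  define q where "q = (LEAST q. P q)"
  have "P q"
    unfolding q_def using \<open>P q0\<close> by (rule LeastI)
  have "frac (orbit \<delta> q) < frac (orbit \<delta> k)" if "0 < k" "k < q" for k
  proof -
    have "\<not> P k"
      using \<open>k < q\<close> not_less_Least unfolding q_def by blast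
    moreover have "k \<le> N"
      using \<open>k < q\<close> \<open>P q\<close> by (simp add: P_def)
    ultimately obtain j where "0 < j" "j \<le> N" "frac (orbit \<delta> j) < frac (orbit \<delta> k)"
      using \<open>0 < k\<close> unfolding P_def not_le[symmetric] by blast
    with \<open>P q\<close> show ?thesis
      unfolding P_def by (meson le_less_trans)
  qed
  with \<open>P q\<close> show ?thesis
    unfolding closest_return_def P_def by blast
qed

text \<open>The smaller parameter must leave its branch before the limiting displacement, while the
  larger one, with the same itinerary, is still on it after \<open>j\<close> returns. This yields
  \<open>t' * (1 - (l ^ q) ^ j) < t\<close>.\<close>

lemma parameters_close:
  fixes n :: nat
  assumes "\<delta> \<le> \<delta>'" and irrational: "rotation_number l \<delta> \<notin> \<rat>"
    and same: "\<And>k. k \<le> 2 * n + 1 \<Longrightarrow> \<lfloor>orbit \<delta>' k\<rfloor> = \<lfloor>orbit \<delta> k\<rfloor>"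
    and q': "closest_return (2 * n + 1) \<delta>' q"
  shows "\<delta>' - \<delta> \<le> l ^ n"
proof -
  let ?N = "2 * n + 1"
  define t where "t = frac (orbit \<delta> q)"
  define t' where "t' = frac (orbit \<delta>' q)"
  \<comment> \<open>One full period is held back, so that \<open>j * q + i\<close> is at most
    \<open>?N\<close> for every \<open>i < q\<close>.\<close>
  define j where "j = ?N div q - 1"
  have q: "0 < q" "q \<le> ?N"
    using q' by (auto simp: closest_return_def)
  have lq: "l ^ q < 1"
    using q l_pos l_less_1 by (simp add: power_less_one_iff)
  have "0 < ?N div q"
    using q by (simp add: div_greater_zero_iff)
  then have j: "(j + 1) * q = ?N div q * q" by (simp add: j_def)
  have "(j + 1) * q \<le> ?N"
    unfolding j by (rule div_times_less_eq_dividend)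
  \<comment> \<open>The choice of \<open>?N\<close> pays off here:
    \<open>?N < (j + 2) * q \<le> 2 * (j + 1) * q\<close> gives
    \<open>n + 1 \<le> (j + 1) * q\<close>.\<close>
  have "?N < (?N div q) * q + q"
    using dividend_less_div_times[OF q(1), of ?N] by (simp only: add.commute)
  moreover have "q \<le> (?N div q) * q"
    using \<open>0 < ?N div q\<close> by simp
  ultimately have exponent: "n \<le> j * q + (q - 1)"
    using j q by (simp only: distrib_right)
  obtain i where i: "i < q"
    "of_int \<lfloor>orbit \<delta> i\<rfloor> + 1 \<le> orbit \<delta> i + l ^ i * (t / (1 - l ^ q))"
    using orbit_escapes_branch[OF q(1) irrational] unfolding t_def by blast
  have "j * q + i \<le> ?N"
    using \<open>(j + 1) * q \<le> ?N\<close> i by simp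
  have returns: "orbit \<delta>' (j * q + i) = orbit \<delta>' i + of_int (int j * \<lfloor>orbit \<delta>' q\<rfloor>)
      + l ^ i * t' * (\<Sum>k<j. (l ^ q) ^ k)
    \<and> \<lfloor>orbit \<delta>' (j * q + i)\<rfloor> = \<lfloor>orbit \<delta>' i\<rfloor> + int j * \<lfloor>orbit \<delta>' q\<rfloor>"
    unfolding t'_def
    by (rule orbit_after_closest_returns[where N = ?N])
      (use q' \<open>j * q + i \<le> ?N\<close> in \<open>auto simp: closest_return_def\<close>)
  have "real_of_int \<lfloor>orbit \<delta>' (j * q + i)\<rfloor>
      = of_int \<lfloor>orbit \<delta>' i\<rfloor> + of_int (int j * \<lfloor>orbit \<delta>' q\<rfloor>)"
    using conjunct2[OF returns] by (simp only: of_int_add)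
  then have "orbit \<delta>' i + l ^ i * t' * (\<Sum>k<j. (l ^ q) ^ k) < of_int \<lfloor>orbit \<delta>' i\<rfloor> + 1"
    using conjunct1[OF returns] by linarith
  also have "\<lfloor>orbit \<delta>' i\<rfloor> = \<lfloor>orbit \<delta> i\<rfloor>"
    using same[of i] i q by simp
  also have "of_int \<lfloor>orbit \<delta> i\<rfloor> + 1 \<le> orbit \<delta> i + l ^ i * (t / (1 - l ^ q))"
    by (rule i)
  also have "\<dots> \<le> orbit \<delta>' i + l ^ i * (t / (1 - l ^ q))"
    using orbit_mono[OF \<open>\<delta> \<le> \<delta>'\<close>] by simp
  finally have "l ^ i * (t' * (\<Sum>k<j. (l ^ q) ^ k)) < l ^ i * (t / (1 - l ^ q))"
    by (simp add: mult.assoc)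
  then have "t' * (\<Sum>k<j. (l ^ q) ^ k) < t / (1 - l ^ q)"
    by (rule mult_left_less_imp_less) (use l_pos in simp)
  also have "(\<Sum>k<j. (l ^ q) ^ k) = (1 - (l ^ q) ^ j) / (1 - l ^ q)"
    using lq by (simp add: sum_gp_strict)
  finally have "t' * (1 - (l ^ q) ^ j) < t"
    using lq by (simp add: divide_less_cancel)
  then have "t' - t \<le> (l ^ q) ^ j * t'"
    by (simp add: algebra_simps)
  also have "t' \<le> l ^ (q - 1)"
    unfolding t'_def using q' by (intro closest_return_le) (auto simp: closest_return_def)
  then have "(l ^ q) ^ j * t' \<le> (l ^ q) ^ j * l ^ (q - 1)"
    using l_pos by (intro mult_left_mono) auto
  also have "\<dots> = l ^ (j * q + (q - 1))"
    by (simp add: power_add mult.commute flip: power_mult)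
  also have "\<dots> \<le> l ^ n"
    using l_pos l_less_1 exponent by (intro power_decreasing) auto
  finally have "t' - t \<le> l ^ n" .
  \<comment> \<open>The integer parts at time \<open>q\<close> agree, so \<open>t' - t\<close> is
    the full distance between the two orbits.\<close>
  moreover have "\<delta>' - \<delta> \<le> t' - t"
    using orbit_diff_ge[OF \<open>\<delta> \<le> \<delta>'\<close> q(1)] same[OF q(2)] unfolding t_def t'_def frac_def by simp
  ultimately show ?thesis by linarith
qed

text \<open>Each \<open>\<lfloor>orbit \<delta> k\<rfloor>\<close> increases with \<open>\<delta>\<close>, so their sum determines every one of them.\<close>

definition itinerary_sum where
  "itinerary_sum N \<delta> = nat (\<Sum>k\<le>N. \<lfloor>orbit \<delta> k\<rfloor>)"

lemma itinerary_sum_le: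
  assumes "0 \<le> \<delta>" "\<delta> < 1"
  shows "itinerary_sum N \<delta> \<le> (N + 1) * N"
proof -
  have "(\<Sum>k\<le>N. \<lfloor>orbit \<delta> k\<rfloor>) \<le> (\<Sum>k\<le>N. int N)"
  proof (intro sum_mono)
    fix k assume "k \<in> {..N}"
    then have "orbit \<delta> k \<le> real N"
      using orbit_bounds(2)[OF assms, of k] by simp
    then show "\<lfloor>orbit \<delta> k\<rfloor> \<le> int N" by linarith
  qed
  then show ?thesis by (simp add: itinerary_sum_def nat_le_iff algebra_simps)
qed

lemma floor_orbit_eq_of_itinerary_sum_eq:
  assumes "0 \<le> \<delta>" "\<delta> \<le> \<delta>'" "\<delta>' < 1"
    and "itinerary_sum N \<delta> = itinerary_sum N \<delta>'" and "k \<le> N"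
  shows "\<lfloor>orbit \<delta>' k\<rfloor> = \<lfloor>orbit \<delta> k\<rfloor>"
proof -
  \<comment> \<open>Since \<open>nat\<close> truncates at 0, equality of the integer sums is
    recovered only for nonnegative sums.\<close>
  have nonneg: "0 \<le> (\<Sum>k\<le>N. \<lfloor>orbit \<epsilon> k\<rfloor>)" if "0 \<le> \<epsilon>" "\<epsilon> < 1" for \<epsilon>
    using orbit_bounds(1)[OF that] by (intro sum_nonneg) simp
  have sum_eq: "(\<Sum>k\<le>N. \<lfloor>orbit \<delta> k\<rfloor>) = (\<Sum>k\<le>N. \<lfloor>orbit \<delta>' k\<rfloor>)"
    using assms nonneg[of \<delta>] nonneg[of \<delta>'] by (simp add: itinerary_sum_def)
  have "\<lfloor>orbit \<delta> k\<rfloor> \<le> \<lfloor>orbit \<delta>' k\<rfloor>" for k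
    using orbit_mono[OF \<open>\<delta> \<le> \<delta>'\<close>] by (rule floor_mono)
  with sum_eq \<open>k \<le> N\<close> show ?thesis
    by (intro sum_mono_inv[symmetric, of "\<lambda>k. \<lfloor>orbit \<delta> k\<rfloor>" "{..N}"]) auto
qed

lemma irrational_parameters_cover:
  "\<exists>U. {\<delta> \<in> {0..<1}. rotation_number l \<delta> \<notin> \<rat>} \<subseteq> (\<Union>i<irrational_cover_size n. U i)
    \<and> (\<forall>i<irrational_cover_size n. bounded (U i) \<and> diameter (U i) \<le> l ^ n)"
proof -
  define N where "N = 2 * n + 1"
  have size: "irrational_cover_size n = ((N + 1) * N + 1) * (N + 1)"
    by (simp add: irrational_cover_size_def N_def)
  \<comment> \<open>The pair of itinerary sum and return time is packed into one index in base
    \<open>N + 1\<close>, as the return time is at most \<open>N\<close>.\<close>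
  define U where "U i = {\<delta> \<in> {0..<1}. rotation_number l \<delta> \<notin> \<rat>
    \<and> itinerary_sum N \<delta> = i div (N + 1) \<and> closest_return N \<delta> (i mod (N + 1))}" for i
  have close: "dist \<delta> \<delta>' \<le> l ^ n" if "\<delta> \<in> U i" "\<delta>' \<in> U i" for i \<delta> \<delta>'
    using that
  proof (induction \<delta> \<delta>' rule: linorder_wlog)
    case (le \<delta> \<delta>')
    then have "\<delta>' - \<delta> \<le> l ^ n"
      using floor_orbit_eq_of_itinerary_sum_eq[of \<delta> \<delta>' N]
      by (intro parameters_close[where q = "i mod (N + 1)"]) (auto simp: U_def N_def)
    with le show ?case by (simp add: dist_real_def)
  qed (simp add: dist_commute)
  have "\<exists>i<irrational_cover_size n. \<delta> \<in> U i"
    if "0 \<le> \<delta>" "\<delta> < 1" "rotation_number l \<delta> \<notin> \<rat>" for \<delta>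
  proof -
    obtain q where q: "closest_return N \<delta> q"
      using closest_return_exists[of N \<delta>] by (auto simp: N_def)
    then have "q < N + 1" by (simp add: closest_return_def)
    let ?i = "itinerary_sum N \<delta> * (N + 1) + q"
    have "?i div (N + 1) = itinerary_sum N \<delta>"
      using \<open>q < N + 1\<close> by (metis add.commute add_cancel_right_left div_less div_mult_self1
          less_nat_zero_code)
    moreover have "?i mod (N + 1) = q"
      using \<open>q < N + 1\<close> by (metis mod_less mod_mult_self3)
    ultimately have "\<delta> \<in> U ?i"
      using that q by (simp add: U_def)
    moreover have "?i < (itinerary_sum N \<delta> + 1) * (N + 1)"
      using \<open>q < N + 1\<close> by (simp add: algebra_simps)
    moreover have "\<dots> \<le> ((N + 1) * N + 1) * (N + 1)"
      using itinerary_sum_le[OF that(1,2), of N] by (intro mult_right_mono) auto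
    ultimately show ?thesis unfolding size by (meson less_le_trans)
  qed
  moreover have "bounded (U i)" for i
    by (rule bounded_subset[of "{0..1}"]) (auto simp: U_def)
  moreover have "diameter (U i) \<le> l ^ n" for i
    using close l_pos by (intro diameter_le) (auto simp: dist_norm)
  ultimately show ?thesis
    by (intro exI[of _ U] conjI subsetI) (simp_all add: Bex_def)
qed

end

theorem theorem4:
  fixes l :: real
  assumes "0 < l" and "l < 1"
  shows "hausdorff_dim {\<delta> \<in> {0..<1}. rotation_number l \<delta> \<notin> \<rat>} = 0"
proof (rule hausdorff_dim_eq_0I)
  show "\<exists>U. {\<delta> \<in> {0..<1}. rotation_number l \<delta> \<notin> \<rat>} \<subseteq> (\<Union>i<irrational_cover_size n. U i)
    \<and> (\<forall>i<irrational_cover_size n. bounded (U i) \<and> diameter (U i) \<le> l ^ n)" for n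
    using assms by (rule irrational_parameters_cover)
  show "(\<lambda>n. l ^ n) \<longlonglongrightarrow> 0"
    using assms by (intro LIMSEQ_power_zero) simp
  fix s :: real assume "0 < s"
  \<comment> \<open>With this \<open>c\<close>, \<open>(l ^ n) powr s\<close> equals
    \<open>exp (- c * n)\<close>, which beats the cubic number of sets.\<close>
  define c where "c = - s * ln l"
  have "0 < c"
    using assms \<open>0 < s\<close> by (simp add: c_def mult_pos_neg)
  then have "(\<lambda>n. ((2 * real n + 2) * (2 * real n + 1) + 1) * (2 * real n + 2) * exp (- c * real n))
    \<longlonglongrightarrow> 0"
    by real_asymp
  moreover have "(l ^ n) powr s = exp (- c * real n)" for n
    using assms by (simp add: powr_def ln_realpow c_def mult_ac)
  moreover have "real (irrational_cover_size n)
    = ((2 * real n + 2) * (2 * real n + 1) + 1) * (2 * real n + 2)" for n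
    unfolding irrational_cover_size_def by (simp add: algebra_simps)
  ultimately show "(\<lambda>n. real (irrational_cover_size n) * (l ^ n) powr s) \<longlonglongrightarrow> 0"
    by simp
qed

end
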